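(* Let $G$ be an infinite finitely generated group, let $p\in[1,2]$, and let $X$ be a Banach space which has modulus of smoothness of power type $p$. Then $$\alpha^\#_X(G)\le \frac{1}{p\,\beta^*(G)}.$$
   Context: For a finite symmetric generating set $S$ of $G$ (symmetric: $s\in S\iff s^{-1}\in S$), $d_G$ denotes the left-invariant word metric on $G$ induced by $S$. Equivariant maps: let $\mathrm{Isom}(X)$ be the group of linear isometric automorphisms of $X$. Given a homomorphism $\pi:G\to \mathrm{Isom}(X)$, a $1$-cocycle with respect to $\pi$ is a map $f:G\to X$ with $f(xy)=\pi(x)f(y)+f(x)$ for all $x,y\in G$. A map $\psi:G\to X$ is equivariant if it is the orbit map of a vector $v\in X$ under an affine isometric action of $G$ on $X$, i.e. $\psi(x)=\pi(x)v+f(x)$ for some homomorphism $\pi:G\to \mathrm{Isom}(X)$, some $1$-cocycle $f$ with respect to $\pi$, and some $v\in X$. The equivariant compression exponent $\alpha^\#_X(G)$ is the supremum of all $\alpha\ge 0$ for which there exist a Lipschitz equivariant map $f:G\to X$ and $c>0$ such that $\|f(x)-f(y)\|\ge c\, d_G(x,y)^\alpha$ for all distinct $x,y\in G$ (supremum of the empty set being $0$). It does not depend on $S$. $\beta^*(G)$ is the supremum of all $\beta\ge 0$ for which there exist a finite symmetric generating set $S$ of $G$ and $c>0$ such that $\mathbb{E}[d_G(W_t,e)]\ge c\,t^\beta$ for all $t\in\mathbb{N}$, where $\{W_t\}_{t\ge0}$ is the simple random walk on the Cayley graph of $G$ determined by $S$ started at the identity $e$ (so $W_t$ is distributed as $\sigma_1\cdots\sigma_t$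 with $\sigma_i$ i.i.d. uniform on $S$) and $d_G$ is the word metric of $S$. The convention $1/0=+\infty$ is used. Modulus of smoothness: for $\tau>0$, $\rho_X(\tau)=\sup\{\frac{\|x+\tau y\|+\|x-\tau y\|}{2}-1:\ x,y\in X,\ \|x\|=\|y\|=1\}$. $X$ has modulus of smoothness of power type $p$ if there is a constant $K$ with $\rho_X(\tau)\le K\tau^p$ for all $\tau>0$. *)

theory Defs
  imports "HOL-Probability.Probability" "HOL-Algebra.Generated_Groups"
begin

definition fin_sym_gen_set :: "('a, 'm) monoid_scheme \<Rightarrow> 'a set \<Rightarrow> bool" where
  "fin_sym_gen_set G S \<longleftrightarrow>
     finite S \<and> S \<subseteq> carrier G \<and>
     (\<forall>s\<in>carrier G. s \<in> S \<longleftrightarrow> inv\<^bsub>G\<^esub> s \<in> S) \<and>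
     generate G S = carrier G"

definition word_prod :: "('a, 'm) monoid_scheme \<Rightarrow> 'a list \<Rightarrow> 'a" where
  "word_prod G ws = foldr (\<lambda>x y. x \<otimes>\<^bsub>G\<^esub> y) ws \<one>\<^bsub>G\<^esub>"

definition word_length :: "('a, 'm) monoid_scheme \<Rightarrow> 'a set \<Rightarrow> 'a \<Rightarrow> nat" where
  "word_length G S g = (LEAST n. \<exists>ws. length ws = n \<and> set ws \<subseteq> S \<and> word_prod G ws = g)"

text \<open>Words in \<open>S\<close> alone reach every element because \<open>S\<close> is symmetric, so the minimum in
  \<open>word_length\<close> is attained.\<close>

lemma (in group) fin_sym_gen_set_word:
  assumes "fin_sym_gen_set G S" "g \<in> carrier G"
  shows "\<exists>ws. set ws \<subseteq> S \<and> word_prod G ws = g"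
proof -
  have S: "S \<subseteq> carrier G" "\<And>s. s \<in> S \<Longrightarrow> inv s \<in> S" and g: "g \<in> generate G S"
    using assms by (auto simp: fin_sym_gen_set_def)
  have closed: "word_prod G ws \<in> carrier G" if "set ws \<subseteq> S" for ws
    using that S(1) by (induction ws) (auto simp: word_prod_def)
  have append: "word_prod G (us @ ws) = word_prod G us \<otimes> word_prod G ws"
    if "set us \<subseteq> S" "set ws \<subseteq> S" for us ws
    using that(1)
  proof (induction us)
    case Nil
    then show ?case using closed[OF that(2)] by (simp add: word_prod_def)
  next
    case (Cons u us)
    then have "u \<in> carrier G" "word_prod G us \<in> carrier G"
      using S(1) closed by auto
    then show ?case using Cons closed[OF that(2)] by (simp add: word_prod_def m_assoc)
  qed
  from g show ?thesis
  proof (induction rule: generate.induct)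
    case one
    show ?case by (rule exI[of _ "[]"]) (simp add: word_prod_def)
  next
    case (incl h)
    then show ?case using S(1) by (intro exI[of _ "[h]"]) (auto simp: word_prod_def)
  next
    case (inv h)
    then show ?case using S by (intro exI[of _ "[inv h]"]) (auto simp: word_prod_def)
  next
    case (eng h1 h2)
    then obtain us ws where "set us \<subseteq> S" "word_prod G us = h1" "set ws \<subseteq> S" "word_prod G ws = h2"
      by blast
    then show ?case using append by (intro exI[of _ "us @ ws"]) auto
  qed
qed

definition word_dist :: "('a, 'm) monoid_scheme \<Rightarrow> 'a set \<Rightarrow> 'a \<Rightarrow> 'a \<Rightarrow> nat" where
  "word_dist G S x y = word_length G S (inv\<^bsub>G\<^esub> x \<otimes>\<^bsub>G\<^esub> y)"

definition Isom :: "('b::real_normed_vector \<Rightarrow> 'b) monoid" where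
  "Isom = \<lparr>carrier = {T. linear T \<and> (\<forall>x. norm (T x) = norm x) \<and> bij T}, mult = (\<circ>), one = id\<rparr>"

lemma group_Isom: "group (Isom :: ('b::real_normed_vector \<Rightarrow> 'b) monoid)"
proof (rule groupI)
  fix T :: "'b \<Rightarrow> 'b"
  assume "T \<in> carrier Isom"
  then have T: "linear T" "\<And>x. norm (T x) = norm x" "bij T" by (auto simp: Isom_def)
  have "linear (inv_into UNIV T)"
  proof (rule linearI)
    note inv_simps = inv_f_f[OF bij_is_inj[OF T(3)]] surj_f_inv_f[OF bij_is_surj[OF T(3)]]
    show "inv_into UNIV T (x + y) = inv_into UNIV T x + inv_into UNIV T y" for x y
      using inv_simps(1)[of "inv_into UNIV T x + inv_into UNIV T y"]
      by (simp add: linear_add[OF T(1)] inv_simps(2))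
    show "inv_into UNIV T (r *\<^sub>R x) = r *\<^sub>R inv_into UNIV T x" for r x
      using inv_simps(1)[of "r *\<^sub>R inv_into UNIV T x"]
      by (simp add: linear_scale[OF T(1)] inv_simps(2))
  qed
  moreover have "norm (inv_into UNIV T x) = norm x" for x
    using T(2)[of "inv_into UNIV T x"] T(3) by (simp add: bij_is_surj surj_f_inv_f)
  ultimately have "inv_into UNIV T \<in> carrier Isom"
    using T(3) by (simp add: Isom_def bij_imp_bij_inv)
  moreover have "inv_into UNIV T \<circ> T = id" using T(3) by (simp add: bij_is_inj)
  ultimately show "\<exists>U\<in>carrier Isom. U \<otimes>\<^bsub>Isom\<^esub> T = \<one>\<^bsub>Isom\<^esub>"
    by (auto simp: Isom_def)
qed (auto simp: Isom_def linear_compose bij_comp o_assoc linear_id)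

definition cocycle ::
  "('a, 'm) monoid_scheme \<Rightarrow> ('a \<Rightarrow> 'b::real_normed_vector \<Rightarrow> 'b) \<Rightarrow> ('a \<Rightarrow> 'b) \<Rightarrow> bool" where
  "cocycle G \<pi> f \<longleftrightarrow>
     (\<forall>x\<in>carrier G. \<forall>y\<in>carrier G. f (x \<otimes>\<^bsub>G\<^esub> y) = \<pi> x (f y) + f x)"

definition equivariant_map ::
  "('a, 'm) monoid_scheme \<Rightarrow> ('a \<Rightarrow> 'b::real_normed_vector) \<Rightarrow> bool" where
  "equivariant_map G \<psi> \<longleftrightarrow>
     (\<exists>\<pi> f v. \<pi> \<in> hom G Isom \<and> cocycle G \<pi> f \<and> (\<forall>x\<in>carrier G. \<psi> x = \<pi> x v + f x))"

definition word_Lipschitz ::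
  "('a, 'm) monoid_scheme \<Rightarrow> 'a set \<Rightarrow> ('a \<Rightarrow> 'b::real_normed_vector) \<Rightarrow> bool" where
  "word_Lipschitz G S \<psi> \<longleftrightarrow>
     (\<exists>L. \<forall>x\<in>carrier G. \<forall>y\<in>carrier G. norm (\<psi> x - \<psi> y) \<le> L * real (word_dist G S x y))"

text \<open>The exponents below live in \<^typ>\<open>ennreal\<close>, where \<open>Sup {} = 0\<close> and \<open>1 / 0 = \<infinity>\<close>.
  The value of \<open>equivariant_compression\<close> does not depend on the finite symmetric
  generating set \<open>S\<close>.\<close>

definition equivariant_compression ::
  "('a, 'm) monoid_scheme \<Rightarrow> 'a set \<Rightarrow> 'b::real_normed_vector itself \<Rightarrow> ennreal" where
  "equivariant_compression G S (X :: 'b itself) =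
     Sup {ennreal \<alpha> | \<alpha>. 0 \<le> \<alpha> \<and>
       (\<exists>(f :: 'a \<Rightarrow> 'b) c. equivariant_map G f \<and> word_Lipschitz G S f \<and> 0 < c \<and>
          (\<forall>x\<in>carrier G. \<forall>y\<in>carrier G. x \<noteq> y \<longrightarrow>
             c * real (word_dist G S x y) powr \<alpha> \<le> norm (f x - f y)))}"

definition random_walk :: "('a, 'm) monoid_scheme \<Rightarrow> 'a set \<Rightarrow> nat \<Rightarrow> 'a pmf" where
  "random_walk G S t = map_pmf (word_prod G) (replicate_pmf t (pmf_of_set S))"

text \<open>Since \<open>0 powr \<beta> = 0\<close> also for \<open>\<beta> = 0\<close>, the time \<open>t = 0\<close> imposes no condition.\<close>

definition speed_exponent :: "('a, 'm) monoid_scheme \<Rightarrow> ennreal" where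
  "speed_exponent G =
     Sup {ennreal \<beta> | \<beta>. 0 \<le> \<beta> \<and>
       (\<exists>S c. fin_sym_gen_set G S \<and> 0 < c \<and>
          (\<forall>t::nat. c * real t powr \<beta> \<le>
             measure_pmf.expectation (random_walk G S t)
               (\<lambda>g. real (word_dist G S g \<one>\<^bsub>G\<^esub>))))}"

definition modulus_of_smoothness :: "'b::real_normed_vector itself \<Rightarrow> real \<Rightarrow> ereal" where
  "modulus_of_smoothness (X :: 'b itself) \<tau> =
     Sup {ereal ((norm (x + \<tau> *\<^sub>R y) + norm (x - \<tau> *\<^sub>R y)) / 2 - 1) | x y :: 'b.
            norm x = 1 \<and> norm y = 1}"

definition smoothness_power_type :: "'b::real_normed_vector itself \<Rightarrow> real \<Rightarrow> bool" where
  "smoothness_power_type X p \<longleftrightarrow>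
     (\<exists>K::real. \<forall>\<tau>>0. modulus_of_smoothness X \<tau> \<le> ereal (K * \<tau> powr p))"

end

theory Submission
  imports Defs "HOL-Real_Asymp.Real_Asymp"
begin

text \<open>
  A random walk \<open>W\<^sub>t = \<sigma>\<^sub>1 \<cdots> \<sigma>\<^sub>t\<close> cannot escape faster than at rate \<open>t\<^bsup>1/p\<^esup>\<close> when it is
  observed through a cocycle \<open>f\<close> into a \<open>p\<close>-smooth space: \<open>E \<parallel>f(W\<^sub>t)\<parallel>\<^sup>p\<close> grows at most linearly
  in \<open>t\<close>. If \<open>f\<close> also has compression exponent \<open>\<alpha>\<close>, then \<open>E d(W\<^sub>t, e)\<^bsup>\<alpha>p\<^esup>\<close> grows at most linearly.
  For \<open>\<alpha>p \<ge> 1\<close> Jensen's inequality turns a lower bound \<open>t\<^sup>\<beta>\<close> on the speed into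
  \<open>t\<^bsup>\<alpha>p\<beta>\<^esup> = O(t)\<close>, so that \<open>\<alpha>p\<beta> \<le> 1\<close>; for \<open>\<alpha>p < 1\<close> the trivial bound \<open>\<beta> \<le> 1\<close> suffices
  (\<open>compression_speed_product_le\<close>).

  The linear growth (\<open>cocycle_moment_bound\<close>) would be the usual martingale type inequality if the
  increments \<open>f(W\<^bsub>i\<^esub>) - f(W\<^bsub>i-1\<^esub>) = \<pi>(W\<^bsub>i-1\<^esub>) f(\<sigma>\<^sub>i)\<close> had conditional mean zero. Their
  conditional mean is \<open>\<pi>(W\<^bsub>i-1\<^esub>) m\<close>, where \<open>m\<close> is the mean of \<open>f(\<sigma>\<^sub>1)\<close>. With the accumulated drift
  \<open>D\<^sub>t = \<pi>(W\<^sub>0) m + \<cdots> + \<pi>(W\<^bsub>t-1\<^esub>) m\<close>, the process \<open>M\<^sub>t = f(W\<^sub>t) - D\<^sub>t\<close> is a martingale. By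
  symmetry of the generators the walk is reversible, and compensating the reversed walk in the same
  way leads, up to an isometry, to \<open>N\<^sub>t = f(W\<^sub>t) + D\<^sub>t + \<pi>(W\<^sub>t) m - m\<close>, in which the drift has the
  opposite sign. In the sum
  \<open>2 f(W\<^sub>t) = M\<^sub>t + N\<^sub>t + m - \<pi>(W\<^sub>t) m\<close>
  the drift cancels and only a bounded error remains.

  Both processes are controlled step by step: in a \<open>p\<close>-smooth space, adding a centred random vector
  \<open>Y\<close> to a fixed vector raises the \<open>p\<close>-th moment of the norm by at most \<open>C E \<parallel>Y\<parallel>\<^sup>p\<close>
  (\<open>smooth_mean_zero\<close>). All expectations are finite averages over the words of length \<open>t\<close>: a
  step of \<open>M\<close> appends a letter, a step of \<open>N\<close> prepends one.
\<close>

section \<open>Power means and smoothness\<close>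

text \<open>Jensen's inequality for \<open>x\<^sup>q\<close>, summed from the tangent line at \<open>A\<close>: Young's inequality
  with exponents \<open>1/q\<close> and \<open>1 - 1/q\<close> says that the graph lies above it.\<close>

lemma power_mean_bound:
  fixes a :: "'i \<Rightarrow> real" and A q :: real
  assumes "1 \<le> q" "0 \<le> A" "\<And>i. i \<in> T \<Longrightarrow> 0 \<le> a i" "card T * A \<le> (\<Sum>i\<in>T. a i)"
  shows "card T * A powr q \<le> (\<Sum>i\<in>T. a i powr q)"
proof (cases "A = 0")
  case True
  then show ?thesis by (simp add: sum_nonneg)
next
  case False
  then have A: "0 < A" using assms by simp
  have tangent: "q * A powr (q - 1) * a i \<le> a i powr q + (q - 1) * A powr q" if "i \<in> T" for i
  proof (cases "a i = 0")
    case True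
    then show ?thesis using assms by simp
  next
    case False
    then have "0 < a i" using assms(3)[OF that] by simp
    then have "(a i powr q) powr (1 / q) * (A powr q) powr (1 - 1 / q)
        \<le> 1 / q * a i powr q + (1 - 1 / q) * A powr q"
      using assms A by (intro Youngs_inequality_0) auto
    moreover have "(a i powr q) powr (1 / q) = a i"
      using assms that by (simp add: powr_powr)
    moreover have "(A powr q) powr (1 - 1 / q) = A powr (q - 1)"
    proof -
      have "q * (1 - 1 / q) = q - 1" using assms by (simp add: right_diff_distrib)
      then show ?thesis by (simp only: powr_powr)
    qed
    ultimately have "a i * A powr (q - 1) \<le> 1 / q * a i powr q + (1 - 1 / q) * A powr q"
      by simp
    then have "q * (a i * A powr (q - 1)) \<le> q * (1 / q * a i powr q + (1 - 1 / q) * A powr q)"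
      using assms by (intro mult_left_mono) auto
    also have "\<dots> = a i powr q + (q - 1) * A powr q"
      using assms by (simp add: field_simps)
    finally show ?thesis by (simp add: mult_ac)
  qed
  have "q * (card T * A powr q) = q * A powr (q - 1) * (card T * A)"
    using A by (simp add: powr_diff)
  also have "\<dots> \<le> q * A powr (q - 1) * (\<Sum>i\<in>T. a i)"
    using assms by (intro mult_left_mono) auto
  also have "\<dots> \<le> (\<Sum>i\<in>T. a i powr q + (q - 1) * A powr q)"
    unfolding sum_distrib_left by (intro sum_mono tangent)
  also have "\<dots> = (\<Sum>i\<in>T. a i powr q) + (q - 1) * (card T * A powr q)"
    by (simp add: sum.distrib)
  finally show ?thesis by (simp add: algebra_simps)
qed

text \<open>Concavity of \<open>u\<^bsup>p/2\<^esup>\<close> puts \<open>a\<^sup>p = (a\<^sup>2)\<^bsup>p/2\<^esup>\<close> below its tangent in \<open>u = a\<^sup>2\<close> at \<open>1\<close>, which is a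
  quadratic in \<open>a\<close>. It converts the bound on \<open>\<parallel>x + y\<parallel> + \<parallel>x - y\<parallel>\<close> given by smoothness into a bound on
  the \<open>p\<close>-th powers.\<close>

lemma powr_le_quadratic:
  fixes a p :: real
  assumes "0 \<le> a" "0 \<le> p" "p \<le> 2"
  shows "a powr p \<le> 1 + p * (a - 1) + p / 2 * (a - 1)\<^sup>2"
proof (cases "a = 0")
  case True
  then show ?thesis using assms by simp
next
  case False
  then have "(a\<^sup>2) powr (p / 2) * 1 powr (1 - p / 2) \<le> p / 2 * a\<^sup>2 + (1 - p / 2) * 1"
    using assms by (intro Youngs_inequality_0) auto
  moreover have "(a\<^sup>2) powr (p / 2) = a powr p"
  proof -
    have "a\<^sup>2 = a powr 2" using assms False by simp
    then show ?thesis by (simp only: powr_powr) simp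
  qed
  moreover have "p / 2 * a\<^sup>2 + (1 - p / 2) * 1 = 1 + p * (a - 1) + p / 2 * (a - 1)\<^sup>2"
    by (simp add: power2_eq_square field_simps)
  ultimately show ?thesis by simp
qed

text \<open>For \<open>\<parallel>y\<parallel> \<le> 1\<close> the first-order terms of the two quadratic bounds add up to the quantity that the
  modulus of smoothness controls, and the second-order terms are at most
  \<open>\<parallel>y\<parallel>\<^sup>2 \<le> \<parallel>y\<parallel>\<^sup>p\<close>. For \<open>\<parallel>y\<parallel> > 1\<close> the triangle inequality is enough.\<close>

lemma smooth_two_point_unit:
  fixes x y :: "'b::real_normed_vector"
  assumes p: "1 \<le> p" "p \<le> 2" and x: "norm x = 1" and y: "y \<noteq> 0"
    and K: "\<And>\<tau>. 0 < \<tau> \<Longrightarrow> modulus_of_smoothness TYPE('b) \<tau> \<le> ereal (K * \<tau> powr p)"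
  shows "norm (x + y) powr p + norm (x - y) powr p \<le> 2 + (4 * \<bar>K\<bar> + 8) * norm y powr p"
proof -
  define \<tau> where "\<tau> = norm y"
  have \<tau>: "0 < \<tau>" using y by (simp add: \<tau>_def)
  have tri: "\<bar>norm (x + y) - 1\<bar> \<le> \<tau>" "\<bar>norm (x - y) - 1\<bar> \<le> \<tau>"
    using norm_triangle_ineq3[of "x + y" x] norm_triangle_ineq3[of "x - y" x]
    by (auto simp: \<tau>_def x)
  show ?thesis
  proof (cases "\<tau> \<le> 1")
    case True
    define u where "u = y /\<^sub>R \<tau>"
    have u: "norm u = 1" "y = \<tau> *\<^sub>R u" using y by (auto simp: u_def \<tau>_def)
    have "ereal ((norm (x + y) + norm (x - y)) / 2 - 1) \<le> modulus_of_smoothness TYPE('b) \<tau>"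
      unfolding modulus_of_smoothness_def u(2) by (rule Sup_upper) (use x u in auto)
    also have "\<dots> \<le> ereal (K * \<tau> powr p)" by (rule K[OF \<tau>])
    finally have "norm (x + y) + norm (x - y) - 2 \<le> 2 * (K * \<tau> powr p)"
      by (simp add: field_simps)
    also have "\<dots> \<le> 2 * (\<bar>K\<bar> * \<tau> powr p)" by (intro mult_left_mono mult_right_mono) auto
    finally have "p * (norm (x + y) + norm (x - y) - 2) \<le> p * (2 * (\<bar>K\<bar> * \<tau> powr p))"
      using p by (intro mult_left_mono) auto
    also have "\<dots> \<le> 2 * (2 * (\<bar>K\<bar> * \<tau> powr p))" using p by (intro mult_right_mono) auto
    finally have lin: "p * (norm (x + y) + norm (x - y) - 2) \<le> 4 * \<bar>K\<bar> * \<tau> powr p" by simp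
    have "\<tau>\<^sup>2 = \<tau> powr 2" using \<tau> by simp
    also have "\<dots> \<le> \<tau> powr p" using p \<tau> True by (intro powr_mono') auto
    finally have sq: "\<tau>\<^sup>2 \<le> \<tau> powr p" .
    have "p / 2 * z\<^sup>2 \<le> \<tau>\<^sup>2" if "\<bar>z\<bar> \<le> \<tau>" for z
    proof -
      have "p / 2 * z\<^sup>2 \<le> 1 * z\<^sup>2" using p by (intro mult_right_mono) auto
      also have "\<dots> \<le> \<tau>\<^sup>2" using that power_mono[OF that, of 2] by simp
      finally show ?thesis .
    qed
    note quad = this[OF tri(1)] this[OF tri(2)]
    have "norm (x + y) powr p + norm (x - y) powr p
        \<le> (1 + p * (norm (x + y) - 1) + p / 2 * (norm (x + y) - 1)\<^sup>2)
          + (1 + p * (norm (x - y) - 1) + p / 2 * (norm (x - y) - 1)\<^sup>2)"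
      using p by (intro add_mono powr_le_quadratic) auto
    also have "\<dots> = 2 + p * (norm (x + y) + norm (x - y) - 2)
        + p / 2 * (norm (x + y) - 1)\<^sup>2 + p / 2 * (norm (x - y) - 1)\<^sup>2"
      by (simp add: algebra_simps)
    also have "\<dots> \<le> 2 + 4 * \<bar>K\<bar> * \<tau> powr p + \<tau> powr p + \<tau> powr p"
      using lin quad sq by linarith
    also have "\<dots> \<le> 2 + (4 * \<bar>K\<bar> + 8) * \<tau> powr p" by (simp add: algebra_simps)
    finally show ?thesis by (simp add: \<tau>_def)
  next
    case False
    have "(2 * \<tau>) powr p = 2 powr p * \<tau> powr p" using \<tau> by (simp add: powr_mult)
    also have "\<dots> \<le> 2 powr 2 * \<tau> powr p" using p by (intro mult_right_mono powr_mono) auto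
    finally have 4: "(2 * \<tau>) powr p \<le> 4 * \<tau> powr p" by simp
    have "norm (x + y) powr p \<le> (2 * \<tau>) powr p" "norm (x - y) powr p \<le> (2 * \<tau>) powr p"
      using tri False p by (intro powr_mono2; auto)+
    moreover have "0 \<le> \<bar>K\<bar> * \<tau> powr p" by simp
    ultimately show ?thesis using 4 unfolding \<tau>_def[symmetric] ring_distribs by linarith
  qed
qed

lemma smooth_two_point:
  assumes p: "1 \<le> p" "p \<le> 2" and smooth: "smoothness_power_type TYPE('b::real_normed_vector) p"
  shows "\<exists>C\<ge>0. \<forall>x y :: 'b. norm (x + y) powr p + norm (x - y) powr p
                          \<le> 2 * norm x powr p + C * norm y powr p"
proof -
  obtain K where K: "\<And>\<tau>. 0 < \<tau> \<Longrightarrow> modulus_of_smoothness TYPE('b) \<tau> \<le> ereal (K * \<tau> powr p)"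
    using smooth unfolding smoothness_power_type_def by blast
  have "norm (x + y) powr p + norm (x - y) powr p
      \<le> 2 * norm x powr p + (4 * \<bar>K\<bar> + 8) * norm y powr p" for x y :: 'b
  proof (cases "x = 0 \<or> y = 0")
    case True
    then show ?thesis by (auto simp: algebra_simps)
  next
    case False
    define r where "r = norm x"
    have r: "0 < r" using False by (simp add: r_def)
    have "norm (x /\<^sub>R r + y /\<^sub>R r) powr p + norm (x /\<^sub>R r - y /\<^sub>R r) powr p
        \<le> 2 + (4 * \<bar>K\<bar> + 8) * norm (y /\<^sub>R r) powr p"
      using False r by (intro smooth_two_point_unit p K) (auto simp: r_def)
    moreover have "norm (z /\<^sub>R r) powr p = norm z powr p / r powr p" for z :: 'b
      using r by (simp add: powr_divide divide_inverse[symmetric] inverse_eq_divide)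
    moreover have "x /\<^sub>R r + y /\<^sub>R r = (x + y) /\<^sub>R r" "x /\<^sub>R r - y /\<^sub>R r = (x - y) /\<^sub>R r"
      by (simp_all add: algebra_simps)
    ultimately have "norm (x + y) powr p / r powr p + norm (x - y) powr p / r powr p
        \<le> 2 + (4 * \<bar>K\<bar> + 8) * (norm y powr p / r powr p)"
      by simp
    then have "(norm (x + y) powr p / r powr p + norm (x - y) powr p / r powr p) * r powr p
        \<le> (2 + (4 * \<bar>K\<bar> + 8) * (norm y powr p / r powr p)) * r powr p"
      by (intro mult_right_mono) auto
    then show ?thesis using r by (simp add: ring_distribs add_divide_distrib flip: r_def)
  qed
  then show ?thesis by (intro exI[of _ "4 * \<bar>K\<bar> + 8"]) auto
qed

text \<open>The two-point inequality controls \<open>x + Y\<close> and \<open>x - Y\<close> together; since \<open>x\<close> is the mean of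
  \<open>x - Y\<close>, Jensen's inequality gives the latter at least the \<open>p\<close>-th moment of the constant \<open>x\<close>, and
  this can be subtracted.\<close>

lemma smooth_mean_zero:
  fixes Y :: "'i \<Rightarrow> 'b::real_normed_vector"
  assumes p: "1 \<le> p" and mean: "(\<Sum>s\<in>T. Y s) = 0"
    and C: "\<And>x y :: 'b. norm (x + y) powr p + norm (x - y) powr p
                          \<le> 2 * norm x powr p + C * norm y powr p"
  shows "(\<Sum>s\<in>T. norm (x + Y s) powr p) \<le> card T * norm x powr p + C * (\<Sum>s\<in>T. norm (Y s) powr p)"
proof -
  have "card T * norm x = norm (\<Sum>s\<in>T. x - Y s)"
    by (simp add: sum_subtractf mean sum_constant_scaleR)
  also have "\<dots> \<le> (\<Sum>s\<in>T. norm (x - Y s))" by (rule norm_sum)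
  finally have "card T * norm x powr p \<le> (\<Sum>s\<in>T. norm (x - Y s) powr p)"
    using p by (intro power_mean_bound) auto
  moreover have "(\<Sum>s\<in>T. norm (x + Y s) powr p + norm (x - Y s) powr p)
      \<le> (\<Sum>s\<in>T. 2 * norm x powr p + C * norm (Y s) powr p)"
    by (intro sum_mono C)
  ultimately show ?thesis by (simp add: sum.distrib sum_distrib_left)
qed

section \<open>Words of fixed length\<close>

definition words :: "'a set \<Rightarrow> nat \<Rightarrow> 'a list set" where
  "words T t = {ws. set ws \<subseteq> T \<and> length ws = t}"

lemma finite_words: "finite T \<Longrightarrow> finite (words T t)"
  by (simp add: words_def finite_lists_length_eq)

lemma card_words: "finite T \<Longrightarrow> card (words T t) = card T ^ t"
  by (simp add: words_def card_lists_length_eq)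

lemma words_0: "words T 0 = {[]}"
  by (auto simp: words_def)

lemma sum_words_Suc: "(\<Sum>ws\<in>words T (Suc t). h ws) = (\<Sum>ws\<in>words T t. \<Sum>s\<in>T. h (s # ws))"
proof -
  have "(\<Sum>ws\<in>words T (Suc t). h ws) = (\<Sum>(ws, s)\<in>words T t \<times> T. h (s # ws))"
    unfolding words_def lists_length_Suc_eq
    by (subst sum.reindex) (auto simp: inj_on_def case_prod_unfold)
  then show ?thesis by (simp add: sum.cartesian_product)
qed

lemma sum_words_rev: "(\<Sum>ws\<in>words T t. h (rev ws)) = (\<Sum>ws\<in>words T t. h ws)"
  by (rule sum.reindex_bij_witness[of _ rev rev]) (auto simp: words_def)

text \<open>The martingale induction: if an average step raises \<open>h\<close> by at most \<open>B\<close>, then the mean of \<open>h\<close> over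
  words of length \<open>t\<close> is at most \<open>t B\<close>. Letters are prepended; composing \<open>h\<close> with \<open>rev\<close> covers
  processes that grow at the other end.\<close>

lemma sum_words_growth:
  fixes h :: "'a list \<Rightarrow> real" and B :: real
  assumes T: "finite T" and h0: "h [] \<le> 0"
    and step: "\<And>ws. set ws \<subseteq> T \<Longrightarrow> (\<Sum>s\<in>T. h (s # ws)) \<le> card T * (h ws + B)"
  shows "(\<Sum>ws\<in>words T t. h ws) \<le> real (card T) ^ t * (real t * B)"
proof (induction t)
  case 0
  then show ?case using h0 by (simp add: words_0)
next
  case (Suc t)
  have "(\<Sum>ws\<in>words T (Suc t). h ws) \<le> (\<Sum>ws\<in>words T t. card T * (h ws + B))"
    unfolding sum_words_Suc by (intro sum_mono step) (auto simp: words_def)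
  also have "\<dots> = card T * ((\<Sum>ws\<in>words T t. h ws) + real (card T) ^ t * B)"
    using T by (simp add: sum.distrib card_words flip: sum_distrib_left)
  also have "\<dots> \<le> card T * (real (card T) ^ t * (real t * B) + real (card T) ^ t * B)"
    using Suc by (intro mult_left_mono add_right_mono) auto
  also have "\<dots> = real (card T) ^ Suc t * (real (Suc t) * B)" by (simp add: algebra_simps)
  finally show ?case .
qed

lemma replicate_pmf_of_set:
  assumes "finite T" "T \<noteq> {}"
  shows "replicate_pmf t (pmf_of_set T) = pmf_of_set (words T t)"
proof (rule pmf_eqI)
  fix ws
  have ne: "words T t \<noteq> {}" for t
    using card_words[of T t] assms by force
  have "pmf (replicate_pmf t (pmf_of_set T)) ws = indicator (words T t) ws / real (card T) ^ t"
  proof (induction t arbitrary: ws)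
    case 0
    then show ?case by (auto simp: words_0 pmf_return indicator_def)
  next
    case (Suc t)
    have "replicate_pmf (Suc t) (pmf_of_set T)
        = map_pmf (\<lambda>(s, ws). s # ws) (pair_pmf (pmf_of_set T) (replicate_pmf t (pmf_of_set T)))"
      by (simp add: pair_pmf_def map_bind_pmf)
    moreover have inj: "inj (\<lambda>(s, ws). s # ws)" by (auto simp: inj_def)
    ultimately show ?case
    proof (cases ws)
      case Nil
      then show ?thesis
        using \<open>replicate_pmf (Suc t) _ = _\<close> assms
        by (auto simp: words_def pmf_eq_0_set_pmf)
    next
      case (Cons s us)
      have "pmf (replicate_pmf (Suc t) (pmf_of_set T)) ws
          = pmf (pair_pmf (pmf_of_set T) (replicate_pmf t (pmf_of_set T))) (s, us)"
        using pmf_map_inj'[OF inj, of _ "(s, us)"] \<open>replicate_pmf (Suc t) _ = _\<close> Cons by simp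
      then show ?thesis
        using assms Suc Cons by (auto simp: pmf_pair indicator_def words_def)
    qed
  qed
  then show "pmf (replicate_pmf t (pmf_of_set T)) ws = pmf (pmf_of_set (words T t)) ws"
    using assms ne by (simp add: finite_words card_words)
qed

lemma expectation_random_walk:
  fixes h :: "'a \<Rightarrow> real"
  assumes "finite T" "T \<noteq> {}"
  shows "measure_pmf.expectation (random_walk G T t) h
       = (\<Sum>ws\<in>words T t. h (word_prod G ws)) / real (card T) ^ t"
proof -
  have "words T t \<noteq> {}" using card_words[of T t] assms by force
  then show ?thesis
    unfolding random_walk_def replicate_pmf_of_set[OF assms] integral_map_pmf
    using assms by (subst integral_pmf_of_set) (auto simp: finite_words card_words)
qed

section \<open>Word metrics\<close>

lemma word_prod_Nil [simp]: "word_prod G [] = \<one>\<^bsub>G\<^esub>"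
  by (simp add: word_prod_def)

lemma word_prod_Cons [simp]: "word_prod G (s # ws) = s \<otimes>\<^bsub>G\<^esub> word_prod G ws"
  by (simp add: word_prod_def)

context group
begin

lemma word_prod_closed [intro, simp]: "set ws \<subseteq> carrier G \<Longrightarrow> word_prod G ws \<in> carrier G"
  by (induction ws) auto

lemma word_prod_append:
  "\<lbrakk>set us \<subseteq> carrier G; set ws \<subseteq> carrier G\<rbrakk>
    \<Longrightarrow> word_prod G (us @ ws) = word_prod G us \<otimes> word_prod G ws"
  by (induction us) (auto simp: m_assoc)

lemma word_prod_rev_inv:
  "set ws \<subseteq> carrier G \<Longrightarrow> word_prod G (rev (map (m_inv G) ws)) = inv (word_prod G ws)"
proof (induction ws)
  case (Cons s ws)
  then have "set (rev (map (m_inv G) ws)) \<subseteq> carrier G" by auto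
  then show ?case using Cons by (simp add: word_prod_append inv_mult_group)
qed simp

lemma word_length_le: "set ws \<subseteq> T \<Longrightarrow> word_length G T (word_prod G ws) \<le> length ws"
  unfolding word_length_def by (rule Least_le) auto

lemma word_length_attained:
  assumes "fin_sym_gen_set G T" "g \<in> carrier G"
  obtains ws where "set ws \<subseteq> T" "word_prod G ws = g" "length ws = word_length G T g"
proof -
  have "\<exists>n ws. length ws = n \<and> set ws \<subseteq> T \<and> word_prod G ws = g"
    using fin_sym_gen_set_word[OF assms] by blast
  then have "\<exists>ws. length ws = word_length G T g \<and> set ws \<subseteq> T \<and> word_prod G ws = g"
    unfolding word_length_def by (rule LeastI_ex)
  then show ?thesis using that by blast
qed

lemma word_length_mult:
  assumes T: "fin_sym_gen_set G T" and "g \<in> carrier G" "h \<in> carrier G"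
  shows "word_length G T (g \<otimes> h) \<le> word_length G T g + word_length G T h"
proof -
  obtain us where us: "set us \<subseteq> T" "word_prod G us = g" "length us = word_length G T g"
    using word_length_attained assms by metis
  obtain ws where ws: "set ws \<subseteq> T" "word_prod G ws = h" "length ws = word_length G T h"
    using word_length_attained assms by metis
  have "T \<subseteq> carrier G" using T by (simp add: fin_sym_gen_set_def)
  then have "word_prod G (us @ ws) = g \<otimes> h" using us ws by (subst word_prod_append) auto
  then show ?thesis using word_length_le[of "us @ ws" T] us ws by simp
qed

text \<open>The speed exponent may be realised by generators other than those that define the compression
  exponent; this Lipschitz comparison links the two metrics.\<close>

lemma word_length_change_generators:
  assumes S: "fin_sym_gen_set G S" and T: "fin_sym_gen_set G T"
  obtains K :: nat where "0 < K"
    "\<And>g. g \<in> carrier G \<Longrightarrow> word_length G T g \<le> K * word_length G S g"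
proof
  let ?K = "Suc (\<Sum>s\<in>S. word_length G T s)"
  show "0 < ?K" by simp
  have S': "finite S" "S \<subseteq> carrier G" using S by (auto simp: fin_sym_gen_set_def)
  have bound: "word_length G T (word_prod G ws) \<le> ?K * length ws" if "set ws \<subseteq> S" for ws
    using that
  proof (induction ws)
    case Nil
    then show ?case using word_length_le[of "[]" T] by simp
  next
    case (Cons s ws)
    then have "s \<in> S" "s \<in> carrier G" "set ws \<subseteq> carrier G" using S' by auto
    then have "word_length G T (word_prod G (s # ws))
        \<le> word_length G T s + word_length G T (word_prod G ws)"
      by (simp add: word_length_mult[OF T])
    moreover have "word_length G T s \<le> ?K"
      using S' \<open>s \<in> S\<close> by (intro le_SucI member_le_sum) auto
    ultimately show ?case using Cons by simp
  qed
  show "word_length G T g \<le> ?K * word_length G S g" if "g \<in> carrier G" for g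
    using word_length_attained[OF S that] bound by metis
qed

text \<open>The distance to \<open>\<one>\<close> is the length of the inverse, which symmetry of \<open>T\<close> lets the reversed word of
  inverses represent.\<close>

lemma word_dist_one_le:
  assumes T: "fin_sym_gen_set G T" and ws: "set ws \<subseteq> T"
  shows "word_dist G T (word_prod G ws) \<one> \<le> length ws"
proof -
  have "set ws \<subseteq> carrier G" "set (rev (map (m_inv G) ws)) \<subseteq> T"
    using T ws by (auto simp: fin_sym_gen_set_def)
  then show ?thesis
    using word_length_le[of "rev (map (m_inv G) ws)" T]
    by (simp add: word_dist_def word_prod_rev_inv)
qed

end

section \<open>Random walk moments of cocycles\<close>

text \<open>This is \<open>\<pi>(w\<^sub>0) m + \<cdots> + \<pi>(w\<^bsub>t-1\<^esub>) m\<close>, where \<open>w\<^sub>i\<close> is the product of the first \<open>i\<close> letters.\<close>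

primrec drift :: "('a \<Rightarrow> 'b \<Rightarrow> 'b) \<Rightarrow> 'b \<Rightarrow> 'a list \<Rightarrow> 'b::real_normed_vector" where
  "drift \<pi> m [] = 0"
| "drift \<pi> m (s # ws) = m + \<pi> s (drift \<pi> m ws)"

context group
begin

lemma sum_inv:
  assumes "T \<subseteq> carrier G" "\<And>s. s \<in> T \<Longrightarrow> inv s \<in> T"
  shows "(\<Sum>s\<in>T. h (inv s)) = (\<Sum>s\<in>T. h s)"
  by (rule sum.reindex_bij_witness[of _ "m_inv G" "m_inv G"]) (use assms in auto)

lemma hom_Isom:
  fixes \<pi> :: "'a \<Rightarrow> 'c::real_normed_vector \<Rightarrow> 'c"
  assumes "\<pi> \<in> hom G Isom"
  shows "x \<in> carrier G \<Longrightarrow> linear (\<pi> x)" "x \<in> carrier G \<Longrightarrow> norm (\<pi> x v) = norm v"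
    "\<lbrakk>x \<in> carrier G; y \<in> carrier G\<rbrakk> \<Longrightarrow> \<pi> (x \<otimes> y) v = \<pi> x (\<pi> y v)"
    "\<pi> \<one> v = v"
proof -
  show "x \<in> carrier G \<Longrightarrow> linear (\<pi> x)" "x \<in> carrier G \<Longrightarrow> norm (\<pi> x v) = norm v"
    "\<lbrakk>x \<in> carrier G; y \<in> carrier G\<rbrakk> \<Longrightarrow> \<pi> (x \<otimes> y) v = \<pi> x (\<pi> y v)"
    using assms by (auto simp: hom_def Isom_def Pi_def)
  show "\<pi> \<one> v = v"
    using hom_one[OF assms is_group group_Isom] by (simp add: Isom_def)
qed

lemma cocycle_one:
  assumes "\<pi> \<in> hom G Isom" "cocycle G \<pi> f"
  shows "f \<one> = 0"
proof -
  have "f (\<one> \<otimes> \<one>) = \<pi> \<one> (f \<one>) + f \<one>"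
    using assms(2) unfolding cocycle_def by blast
  then show ?thesis using hom_Isom(4)[OF assms(1)] by simp
qed

text \<open>The orbit map of \<open>v\<close> differs from \<open>f\<close> by the coboundary \<open>\<pi>(x) v - v\<close>, up to the constant \<open>v\<close>.\<close>

lemma equivariant_map_displacement:
  assumes "equivariant_map G \<psi>"
  obtains \<pi> f where "\<pi> \<in> hom G Isom" "cocycle G \<pi> f"
    "\<And>x. x \<in> carrier G \<Longrightarrow> f x = \<psi> x - \<psi> \<one>"
proof -
  obtain \<pi> f v where h: "\<pi> \<in> hom G Isom" "cocycle G \<pi> f"
    and \<psi>: "\<And>x. x \<in> carrier G \<Longrightarrow> \<psi> x = \<pi> x v + f x"
    using assms unfolding equivariant_map_def by blast
  have "\<psi> \<one> = v" using \<psi> h by (simp add: hom_Isom cocycle_one)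
  have "cocycle G \<pi> (\<lambda>x. \<pi> x v - v + f x)"
    using h(2) unfolding cocycle_def
    by (auto simp: hom_Isom(3)[OF h(1)] linear_add[OF hom_Isom(1)[OF h(1)]]
        linear_diff[OF hom_Isom(1)[OF h(1)]])
  with h(1) show thesis by (rule that) (use \<psi> \<open>\<psi> \<one> = v\<close> in auto)
qed

lemma drift_snoc:
  assumes "\<pi> \<in> hom G Isom" "set ws \<subseteq> carrier G" "s \<in> carrier G"
  shows "drift \<pi> m (ws @ [s]) = drift \<pi> m ws + \<pi> (word_prod G ws) m"
  using assms(2)
proof (induction ws)
  case Nil
  then show ?case
    using linear_0[OF hom_Isom(1)[OF assms(1,3)]] by (simp add: hom_Isom(4)[OF assms(1)])
next
  case (Cons u ws)
  then show ?case
    by (simp add: linear_add[OF hom_Isom(1)[OF assms(1)]] hom_Isom(3)[OF assms(1)])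
qed

text \<open>Appending a uniform random letter changes the compensated process by a vector of mean zero when
  \<open>m\<close> is the mean of \<open>f\<close> over the generators.\<close>

lemma forward_increment:
  assumes "\<pi> \<in> hom G Isom" "cocycle G \<pi> f" "set ws \<subseteq> carrier G" "s \<in> carrier G"
  shows "f (word_prod G (ws @ [s])) - drift \<pi> m (ws @ [s])
       = (f (word_prod G ws) - drift \<pi> m ws) + \<pi> (word_prod G ws) (f s - m)"
proof -
  have "f (word_prod G (ws @ [s])) = \<pi> (word_prod G ws) (f s) + f (word_prod G ws)"
    using assms by (simp add: word_prod_append cocycle_def)
  then show ?thesis
    using assms by (simp add: drift_snoc linear_diff[OF hom_Isom(1)])
qed

text \<open>The same for prepended letters. The cocycle relation at \<open>s\<close> and \<open>inv s\<close> gives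
  \<open>\<pi>(s) f(inv s) = - f(s)\<close>, so the new letter enters through \<open>m - f(inv s)\<close>, which again has mean
  zero over a symmetric set; the outer isometry \<open>\<pi>(s)\<close> does not affect norms. The sign reversal is
  what makes \<open>N\<close> carry the drift with a plus sign.\<close>

lemma backward_increment:
  fixes m :: "'c::real_normed_vector"
  assumes "\<pi> \<in> hom G Isom" "cocycle G \<pi> f" "set ws \<subseteq> carrier G" "s \<in> carrier G"
  defines "N \<equiv> \<lambda>ws. f (word_prod G ws) + drift \<pi> m ws + \<pi> (word_prod G ws) m - m"
  shows "N (s # ws) = \<pi> s (N ws + (m - f (inv s)))"
proof -
  have W: "word_prod G ws \<in> carrier G" using assms by simp
  have "f (s \<otimes> inv s) = \<pi> s (f (inv s)) + f s"
    using assms(2,4) unfolding cocycle_def by blast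
  then have "\<pi> s (f (inv s)) = - f s"
    using cocycle_one[OF assms(1,2)] assms(4) by (simp add: eq_neg_iff_add_eq_0)
  moreover have "f (s \<otimes> word_prod G ws) = \<pi> s (f (word_prod G ws)) + f s"
    using assms(2,4) W unfolding cocycle_def by blast
  ultimately show ?thesis
    using assms(4) W unfolding N_def
    by (simp add: hom_Isom(3)[OF assms(1)] linear_add[OF hom_Isom(1)[OF assms(1)]]
        linear_diff[OF hom_Isom(1)[OF assms(1)]])
qed

text \<open>Both \<open>M\<close> and \<open>N\<close> below grow by centred increments whose \<open>p\<close>-th moments do not depend on the current
  word, as \<open>\<pi>\<close> acts by isometries; their sum determines \<open>2 f\<close> up to an error of norm at most
  \<open>2 \<parallel>m\<parallel>\<close>.\<close>

lemma cocycle_moment_bound: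
  fixes f :: "'a \<Rightarrow> 'c::real_normed_vector"
  assumes \<pi>: "\<pi> \<in> hom G Isom" and f: "cocycle G \<pi> f"
    and T: "finite T" "T \<noteq> {}" "T \<subseteq> carrier G" "\<And>s. s \<in> T \<Longrightarrow> inv s \<in> T"
    and p: "1 \<le> p" "p \<le> 2" and smooth: "smoothness_power_type TYPE('c) p"
  obtains C :: real where "0 \<le> C"
    "\<And>t. (\<Sum>ws\<in>words T t. norm (f (word_prod G ws)) powr p) \<le> real (card T) ^ t * (C * (real t + 1))"
proof -
  obtain C where C: "0 \<le> C" "\<And>x y :: 'c. norm (x + y) powr p + norm (x - y) powr p
                          \<le> 2 * norm x powr p + C * norm y powr p"
    using smooth_two_point[OF p smooth] by blast
  define n where "n = real (card T)"
  have n: "0 < n" using T by (simp add: n_def card_gt_0_iff)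
  define m where "m = (\<Sum>s\<in>T. f s) /\<^sub>R n"
  have mean: "(\<Sum>s\<in>T. f s - m) = 0"
    using n by (simp add: sum_subtractf m_def sum_constant_scaleR n_def)
  define B where "B = C * (\<Sum>s\<in>T. norm (f s - m) powr p) / n"
  have B: "C * (\<Sum>s\<in>T. norm (f s - m) powr p) = n * B" using n by (simp add: B_def)
  have B0: "0 \<le> B" using C n by (simp add: B_def sum_nonneg)
  define M where "M ws = f (word_prod G ws) - drift \<pi> m ws" for ws
  define N where "N ws = f (word_prod G ws) + drift \<pi> m ws + \<pi> (word_prod G ws) m - m" for ws
  have f1: "f \<one> = 0" by (rule cocycle_one[OF \<pi> f])

  have "(\<Sum>ws\<in>words T t. norm (M (rev ws)) powr p) \<le> real (card T) ^ t * (real t * B)" for t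
  proof (rule sum_words_growth[OF T(1)])
    show "norm (M (rev [])) powr p \<le> 0" using f1 by (simp add: M_def)
    fix ws assume "set ws \<subseteq> T"
    then have ws: "set (rev ws) \<subseteq> carrier G" using T by auto
    let ?Y = "\<lambda>s. \<pi> (word_prod G (rev ws)) (f s - m)"
    have W: "linear (\<pi> (word_prod G (rev ws)))"
      using hom_Isom(1)[OF \<pi>] ws word_prod_closed by blast
    have "(\<Sum>s\<in>T. norm (M (rev (s # ws))) powr p) = (\<Sum>s\<in>T. norm (M (rev ws) + ?Y s) powr p)"
      using forward_increment[OF \<pi> f ws] T by (intro sum.cong) (auto simp: M_def)
    also have "\<dots> \<le> card T * norm (M (rev ws)) powr p + C * (\<Sum>s\<in>T. norm (?Y s) powr p)"
      using mean linear_sum[OF W, of "\<lambda>s. f s - m" T] linear_0[OF W]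
      by (intro smooth_mean_zero p C) simp
    also have "(\<Sum>s\<in>T. norm (?Y s) powr p) = (\<Sum>s\<in>T. norm (f s - m) powr p)"
      using hom_Isom(2)[OF \<pi> word_prod_closed[OF ws]] by simp
    also have "card T * norm (M (rev ws)) powr p + C * \<dots> = card T * (norm (M (rev ws)) powr p + B)"
      unfolding B by (simp add: n_def ring_distribs)
    finally show "(\<Sum>s\<in>T. norm (M (rev (s # ws))) powr p)
        \<le> card T * (norm (M (rev ws)) powr p + B)" .
  qed
  then have M: "(\<Sum>ws\<in>words T t. norm (M ws) powr p) \<le> real (card T) ^ t * (real t * B)" for t
    using sum_words_rev[of "\<lambda>ws. norm (M ws) powr p"] by metis

  have N: "(\<Sum>ws\<in>words T t. norm (N ws) powr p) \<le> real (card T) ^ t * (real t * B)" for t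
  proof (rule sum_words_growth[OF T(1)])
    show "norm (N []) powr p \<le> 0" using f1 hom_Isom(4)[OF \<pi>] by (simp add: N_def)
    fix ws assume "set ws \<subseteq> T"
    then have ws: "set ws \<subseteq> carrier G" using T by auto
    have "(\<Sum>s\<in>T. m - f (inv s)) = 0"
      using sum_inv[OF T(3,4), of "\<lambda>s. m - f s"] mean by (simp add: sum_subtractf)
    have "(\<Sum>s\<in>T. norm (N (s # ws)) powr p) = (\<Sum>s\<in>T. norm (N ws + (m - f (inv s))) powr p)"
    proof (intro sum.cong refl)
      fix s assume "s \<in> T"
      then have s: "s \<in> carrier G" using T by auto
      have "N (s # ws) = \<pi> s (N ws + (m - f (inv s)))"
        unfolding N_def by (rule backward_increment[OF \<pi> f ws s])
      then show "norm (N (s # ws)) powr p = norm (N ws + (m - f (inv s))) powr p"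
        using hom_Isom(2)[OF \<pi> s] by simp
    qed
    also have "\<dots> \<le> card T * norm (N ws) powr p + C * (\<Sum>s\<in>T. norm (m - f (inv s)) powr p)"
      by (intro smooth_mean_zero p C) fact
    also have "(\<Sum>s\<in>T. norm (m - f (inv s)) powr p) = (\<Sum>s\<in>T. norm (f s - m) powr p)"
      using sum_inv[OF T(3,4), of "\<lambda>s. norm (m - f s) powr p"] by (simp add: norm_minus_commute)
    also have "card T * norm (N ws) powr p + C * \<dots> = card T * (norm (N ws) powr p + B)"
      unfolding B by (simp add: n_def ring_distribs)
    finally show "(\<Sum>s\<in>T. norm (N (s # ws)) powr p) \<le> card T * (norm (N ws) powr p + B)" .
  qed

  have split: "norm (f (word_prod G ws)) powr p
      \<le> 4 * (norm (M ws) powr p + norm (N ws) powr p + norm m powr p)" if "ws \<in> words T t" for ws t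
  proof -
    have W: "word_prod G ws \<in> carrier G" using that T by (auto simp: words_def)
    \<comment> \<open>Four norms bounded by \<open>z\<close> and a factor \<open>2\<close> on the left give \<open>\<parallel>f\<parallel> \<le> 2 z\<close>, and
        \<open>2\<^sup>p \<le> 4\<close>.\<close>
    define z where "z = max (norm (M ws)) (max (norm (N ws)) (norm m))"
    have "2 *\<^sub>R f (word_prod G ws) = (M ws + N ws) + (m - \<pi> (word_prod G ws) m)"
      by (simp add: M_def N_def scaleR_2)
    then have "norm (2 *\<^sub>R f (word_prod G ws)) = norm ((M ws + N ws) + (m - \<pi> (word_prod G ws) m))"
      by simp
    also have "\<dots> \<le> (norm (M ws) + norm (N ws)) + (norm m + norm (\<pi> (word_prod G ws) m))"
      by (intro norm_triangle_le add_mono norm_triangle_ineq norm_triangle_ineq4)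
    finally have "norm (f (word_prod G ws)) \<le> 2 * z"
      using hom_Isom(2)[OF \<pi> W, of m] by (simp add: z_def)
    then have "norm (f (word_prod G ws)) powr p \<le> (2 * z) powr p"
      using p by (intro powr_mono2) auto
    also have "\<dots> = 2 powr p * z powr p" by (simp add: powr_mult z_def)
    also have "\<dots> \<le> 2 powr 2 * z powr p" using p by (intro mult_right_mono powr_mono) auto
    also have "z powr p \<le> norm (M ws) powr p + norm (N ws) powr p + norm m powr p"
      by (auto simp: z_def max_def)
    finally show ?thesis by simp
  qed
  show thesis
  proof (rule that[of "8 * B + 4 * norm m powr p"])
    show "0 \<le> 8 * B + 4 * norm m powr p" using B0 by simp
    fix t :: nat
    have "(\<Sum>ws\<in>words T t. norm (f (word_prod G ws)) powr p)
        \<le> (\<Sum>ws\<in>words T t. 4 * (norm (M ws) powr p + norm (N ws) powr p + norm m powr p))"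
      by (intro sum_mono split)
    also have "\<dots> = 4 * ((\<Sum>ws\<in>words T t. norm (M ws) powr p)
        + (\<Sum>ws\<in>words T t. norm (N ws) powr p) + real (card T) ^ t * norm m powr p)"
      using T by (simp add: sum.distrib card_words flip: sum_distrib_left)
    also have "\<dots> \<le> 4 * (real (card T) ^ t * (real t * B) + real (card T) ^ t * (real t * B) + real (card T) ^ t * norm m powr p)"
      by (intro mult_left_mono add_mono M N) auto
    also have "\<dots> = real (card T) ^ t * (8 * B * t + 4 * norm m powr p)" by (simp add: algebra_simps)
    also have "\<dots> \<le> real (card T) ^ t * ((8 * B + 4 * norm m powr p) * (real t + 1))"
      using B0 by (intro mult_left_mono) (auto simp: algebra_simps)
    finally show "(\<Sum>ws\<in>words T t. norm (f (word_prod G ws)) powr p)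
        \<le> real (card T) ^ t * ((8 * B + 4 * norm m powr p) * (real t + 1))" .
  qed
qed

end

section \<open>Comparing the exponents\<close>

lemma powr_growth_exponent_le:
  fixes a b x y :: real
  assumes a: "0 < a" and le: "\<And>t::nat. 1 \<le> t \<Longrightarrow> a * real t powr x \<le> b * real t powr y"
  shows "x \<le> y"
proof (rule ccontr)
  assume "\<not> x \<le> y"
  then have "filterlim (\<lambda>t. real t powr (x - y)) at_top sequentially"
    by (intro filterlim_compose[OF real_powr_at_top filterlim_real_sequentially]) simp
  then have "\<forall>\<^sub>F t in sequentially. b / a + 1 \<le> real t powr (x - y)"
    by (simp add: filterlim_at_top)
  then have "\<forall>\<^sub>F t in sequentially. b / a + 1 \<le> real t powr (x - y) \<and> 1 \<le> t"
    using eventually_ge_at_top[of 1] by eventually_elim auto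
  then obtain t :: nat where t: "b / a + 1 \<le> real t powr (x - y)" "1 \<le> t"
    by (auto simp: eventually_sequentially)
  have "real t powr (x - y) = real t powr x / real t powr y" by (rule powr_diff)
  moreover have "real t powr x / real t powr y \<le> b / a"
    using le[OF t(2)] a t(2) by (simp add: field_simps)
  ultimately show False using t(1) by simp
qed

text \<open>For \<open>\<alpha>p \<ge> 1\<close> the growth of \<open>E d(W\<^sub>t, e)\<^bsup>\<alpha>p\<^esup>\<close> is bounded below by the speed, through Jensen's
  inequality, and above by the cocycle moments. For \<open>\<alpha>p < 1\<close> it is enough that a walk moves at most
  one unit per step.\<close>

lemma (in group) compression_speed_product_le:
  fixes \<psi> :: "'a \<Rightarrow> 'c::real_normed_vector"
  assumes S: "fin_sym_gen_set G S" and T: "fin_sym_gen_set G T" and T_ne: "T \<noteq> {}"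
    and p: "1 \<le> p" "p \<le> 2" and smooth: "smoothness_power_type TYPE('c) p"
    and \<psi>: "equivariant_map G \<psi>"
    and \<alpha>: "0 \<le> \<alpha>" and c: "0 < c"
    and compression: "\<And>x y. \<lbrakk>x \<in> carrier G; y \<in> carrier G; x \<noteq> y\<rbrakk>
      \<Longrightarrow> c * real (word_dist G S x y) powr \<alpha> \<le> norm (\<psi> x - \<psi> y)"
    and \<beta>: "0 \<le> \<beta>" and b: "0 < b"
    and speed: "\<And>t. b * real t powr \<beta> \<le>
      measure_pmf.expectation (random_walk G T t) (\<lambda>g. real (word_dist G T g \<one>))"
  shows "\<alpha> * p * \<beta> \<le> 1"
proof -
  have T': "finite T" "T \<subseteq> carrier G" "\<And>s. s \<in> T \<Longrightarrow> inv s \<in> T"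
    using T by (auto simp: fin_sym_gen_set_def)
  define n where "n = real (card T)"
  have n: "0 < n" using T' T_ne by (simp add: n_def card_gt_0_iff)
  define d where "d ws = real (word_dist G T (word_prod G ws) \<one>)" for ws
  have speed': "n ^ t * (b * real t powr \<beta>) \<le> (\<Sum>ws\<in>words T t. d ws)" for t
  proof -
    have "b * real t powr \<beta> \<le> (\<Sum>ws\<in>words T t. d ws) / n ^ t"
      using speed[of t] by (simp add: expectation_random_walk[OF T'(1) T_ne] d_def n_def)
    then show ?thesis using n by (simp add: pos_le_divide_eq mult.commute)
  qed
  have "(\<Sum>ws\<in>words T t. d ws) \<le> (\<Sum>ws\<in>words T t. real t)" for t
    using word_dist_one_le[OF T] by (intro sum_mono) (auto simp: d_def words_def)
  then have "(\<Sum>ws\<in>words T t. d ws) \<le> n ^ t * t" for t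
    using T' by (simp add: card_words n_def)
  then have "n ^ t * (b * real t powr \<beta>) \<le> n ^ t * t" for t
    using speed' order_trans by blast
  then have "b * real t powr \<beta> \<le> real t" for t
    using n by simp
  then have "b * real t powr \<beta> \<le> 1 * real t powr 1" if "1 \<le> t" for t
    using that by simp
  then have "\<beta> \<le> 1" by (rule powr_growth_exponent_le[OF b])
  show ?thesis
  proof (cases "1 \<le> \<alpha> * p")
    case False
    then have "\<alpha> * p * \<beta> \<le> 1 * 1" using \<open>\<beta> \<le> 1\<close> \<alpha> \<beta> p by (intro mult_mono) auto
    then show ?thesis by simp
  next
    case True
    obtain \<pi> f where \<pi>: "\<pi> \<in> hom G Isom" and f: "cocycle G \<pi> f"
      and f\<psi>: "\<And>x. x \<in> carrier G \<Longrightarrow> f x = \<psi> x - \<psi> \<one>"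
      using equivariant_map_displacement[OF \<psi>] by blast
    obtain C :: real where C: "0 \<le> C"
      "\<And>t. (\<Sum>ws\<in>words T t. norm (f (word_prod G ws)) powr p) \<le> real (card T) ^ t * (C * (real t + 1))"
      using cocycle_moment_bound[OF \<pi> f T'(1) T_ne T'(2,3) p smooth] by blast
    obtain K where K: "0 < K"
      "\<And>g. g \<in> carrier G \<Longrightarrow> word_length G T g \<le> K * word_length G S g"
      using word_length_change_generators[OF S T] by blast
    \<comment> \<open>The factor \<open>K\<^sup>\<alpha>\<close> pays for passing from the metric of \<open>S\<close> to that of \<open>T\<close>.\<close>
    define L where "L = real K powr \<alpha> / c"
    have L: "0 \<le> L" using c by (simp add: L_def)
    have lower: "real (word_dist G T g \<one>) powr \<alpha> \<le> L * norm (f g)" if g: "g \<in> carrier G" for g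
    proof (cases "g = \<one>")
      case True
      have "word_dist G T \<one> \<one> = 0"
        using word_length_le[of "[]" T] by (simp add: word_dist_def)
      then show ?thesis using True L by simp
    next
      case False
      have "real (word_dist G T g \<one>) \<le> real K * real (word_dist G S g \<one>)"
        using K(2)[of "inv g \<otimes> \<one>"] g by (simp add: word_dist_def flip: of_nat_mult)
      then have "real (word_dist G T g \<one>) powr \<alpha> \<le> (real K * real (word_dist G S g \<one>)) powr \<alpha>"
        using \<alpha> by (intro powr_mono2) auto
      also have "\<dots> = real K powr \<alpha> * real (word_dist G S g \<one>) powr \<alpha>" by (simp add: powr_mult)
      also have "\<dots> = L * (c * real (word_dist G S g \<one>) powr \<alpha>)" using c by (simp add: L_def)
      also have "\<dots> \<le> L * norm (f g)"
        using compression[of g \<one>] False g f\<psi> L by (intro mult_left_mono) auto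
      finally show ?thesis .
    qed
    have bound: "n ^ t * (b * real t powr \<beta>) powr (\<alpha> * p) \<le> n ^ t * (L powr p * (C * (real t + 1)))" for t
    proof -
      have "n ^ t * (b * real t powr \<beta>) powr (\<alpha> * p) \<le> (\<Sum>ws\<in>words T t. d ws powr (\<alpha> * p))"
        using power_mean_bound[OF True, of "b * real t powr \<beta>" "words T t" d] b speed'[of t] T'
        by (simp add: card_words n_def d_def)
      also have "\<dots> \<le> (\<Sum>ws\<in>words T t. L powr p * norm (f (word_prod G ws)) powr p)"
      proof (rule sum_mono)
        fix ws assume "ws \<in> words T t"
        then have "word_prod G ws \<in> carrier G" using T' by (auto simp: words_def)
        then have "(d ws powr \<alpha>) powr p \<le> (L * norm (f (word_prod G ws))) powr p"
          using lower p by (intro powr_mono2) (auto simp: d_def)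
        then show "d ws powr (\<alpha> * p) \<le> L powr p * norm (f (word_prod G ws)) powr p"
          using L by (simp add: powr_powr powr_mult)
      qed
      also have "\<dots> \<le> L powr p * (real (card T) ^ t * (C * (real t + 1)))"
        unfolding sum_distrib_left[symmetric] by (intro mult_left_mono C) auto
      finally show ?thesis by (simp add: n_def mult_ac)
    qed
    have "b powr (\<alpha> * p) * real t powr (\<beta> * (\<alpha> * p)) \<le> (2 * L powr p * C) * real t powr 1"
      if "1 \<le> t" for t
    proof -
      have "b powr (\<alpha> * p) * real t powr (\<beta> * (\<alpha> * p)) = (b * real t powr \<beta>) powr (\<alpha> * p)"
        using b by (simp add: powr_mult powr_powr)
      also have "\<dots> \<le> L powr p * (C * (real t + 1))" using bound[of t] n by simp
      also have "\<dots> \<le> L powr p * (C * (2 * t))"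
        using that C by (intro mult_left_mono) auto
      finally show ?thesis using that by (simp add: mult_ac)
    qed
    then have "\<beta> * (\<alpha> * p) \<le> 1"
      using b by (intro powr_growth_exponent_le[of "b powr (\<alpha> * p)" _ "2 * L powr p * C" 1])
        (simp_all add: powr_gt_zero)
    then show ?thesis by (simp add: mult_ac)
  qed
qed

text \<open>A bound on all products of real exponents passes to the suprema in \<^typ>\<open>ennreal\<close>, including the
  degenerate cases: if the supremum of \<open>B\<close> is \<open>0\<close>, the right-hand side is \<open>\<infinity>\<close>; if it is \<open>\<infinity>\<close>,
  all elements of \<open>A\<close> vanish.\<close>

lemma ennreal_Sup_le_inverse:
  fixes p :: real
  assumes p: "0 < p" and A: "\<And>a. a \<in> A \<Longrightarrow> 0 \<le> a" and B: "\<And>b. b \<in> B \<Longrightarrow> 0 \<le> b"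
    and AB: "\<And>a b. \<lbrakk>a \<in> A; b \<in> B\<rbrakk> \<Longrightarrow> a * p * b \<le> 1"
  shows "Sup (ennreal ` A) \<le> 1 / (ennreal p * Sup (ennreal ` B))"
proof (rule Sup_least, safe)
  fix a assume a: "a \<in> A"
  show "ennreal a \<le> 1 / (ennreal p * Sup (ennreal ` B))"
  proof (cases "a = 0")
    case False
    then have a0: "0 < a" using A[OF a] by simp
    have "Sup (ennreal ` B) \<le> ennreal (1 / (a * p))"
    proof (rule Sup_least, safe)
      fix b assume "b \<in> B"
      then show "ennreal b \<le> ennreal (1 / (a * p))"
        using AB[OF a, of b] a0 p by (intro ennreal_leI) (simp add: field_simps)
    qed
    then have "ennreal p * Sup (ennreal ` B) \<le> ennreal p * ennreal (1 / (a * p))"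
      by (intro mult_left_mono) auto
    also have "\<dots> = ennreal (1 / a)"
      using p a0 by (simp flip: ennreal_mult)
    finally have "ennreal p * Sup (ennreal ` B) \<le> ennreal (1 / a)" .
    moreover have "ennreal a \<le> 1 / y" if "y \<le> ennreal (1 / a)" for y
    proof (cases y)
      case (real r)
      show ?thesis
      proof (cases "r = 0")
        case False
        then have "0 < r" "r \<le> 1 / a" using real that a0 by auto
        then have "a \<le> 1 / r" using a0 by (simp add: field_simps)
        then show ?thesis
          using real \<open>0 < r\<close> divide_ennreal[of 1 r] by (simp add: ennreal_leI)
      qed (use real in simp)
    qed (use that in \<open>simp add: top_unique\<close>)
    ultimately show ?thesis by blast
  qed simp
qed

theorem theorem1p1:
  fixes G :: "('a, 'm) monoid_scheme" and S :: "'a set" and p :: real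
  assumes "group G" and "infinite (carrier G)" and "fin_sym_gen_set G S"
    and "1 \<le> p" and "p \<le> 2"
    and "smoothness_power_type TYPE('b::banach) p"
  shows "equivariant_compression G S TYPE('b) \<le> 1 / (ennreal p * speed_exponent G)"
proof -
  interpret group G by fact
  define A where "A = {\<alpha>. 0 \<le> \<alpha> \<and>
       (\<exists>(f :: 'a \<Rightarrow> 'b) c. equivariant_map G f \<and> word_Lipschitz G S f \<and> 0 < c \<and>
          (\<forall>x\<in>carrier G. \<forall>y\<in>carrier G. x \<noteq> y \<longrightarrow>
             c * real (word_dist G S x y) powr \<alpha> \<le> norm (f x - f y)))}"
  define B where "B = {\<beta>. 0 \<le> \<beta> \<and>
       (\<exists>T c. fin_sym_gen_set G T \<and> 0 < c \<and>
          (\<forall>t::nat. c * real t powr \<beta> \<le>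
             measure_pmf.expectation (random_walk G T t)
               (\<lambda>g. real (word_dist G T g \<one>\<^bsub>G\<^esub>))))}"
  have "equivariant_compression G S TYPE('b) = Sup (ennreal ` A)"
    unfolding equivariant_compression_def A_def setcompr_eq_image ..
  moreover have "speed_exponent G = Sup (ennreal ` B)"
    unfolding speed_exponent_def B_def setcompr_eq_image ..
  moreover have "Sup (ennreal ` A) \<le> 1 / (ennreal p * Sup (ennreal ` B))"
  proof (rule ennreal_Sup_le_inverse)
    fix \<alpha> \<beta> assume "\<alpha> \<in> A" "\<beta> \<in> B"
    then obtain f :: "'a \<Rightarrow> 'b" and c T b where
      "0 \<le> \<alpha>" "equivariant_map G f" "0 < c"
      and compression: "\<And>x y. \<lbrakk>x \<in> carrier G; y \<in> carrier G; x \<noteq> y\<rbrakk>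
        \<Longrightarrow> c * real (word_dist G S x y) powr \<alpha> \<le> norm (f x - f y)"
      and "0 \<le> \<beta>" and T: "fin_sym_gen_set G T" and "0 < b"
      and speed: "\<And>t. b * real t powr \<beta> \<le>
        measure_pmf.expectation (random_walk G T t) (\<lambda>g. real (word_dist G T g \<one>\<^bsub>G\<^esub>))"
      unfolding A_def B_def by blast
    have "T \<noteq> {}"
    proof
      assume "T = {}"
      then have "carrier G = {\<one>\<^bsub>G\<^esub>}" using T generate_empty by (simp add: fin_sym_gen_set_def)
      then show False using assms(2) by simp
    qed
    show "\<alpha> * p * \<beta> \<le> 1"
      by (rule compression_speed_product_le[OF assms(3) T \<open>T \<noteq> {}\<close> assms(4-6)
            \<open>equivariant_map G f\<close> \<open>0 \<le> \<alpha>\<close> \<open>0 < c\<close> compression \<open>0 \<le> \<beta>\<close> \<open>0 < b\<close> speed])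
  qed (use assms(4) in \<open>auto simp: A_def B_def\<close>)
  ultimately show ?thesis by simp
qed

end
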